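(* For any irreducible random walk on a countable discrete group $\Gamma$, with $R$ the radius of convergence of its Green's functions, one has for all $x,y\in\Gamma$ and all $0<r<R$ $$\frac{d}{dr}G_r(x,y)=r^{-1}\sum_{z\in\Gamma}G_r(x,z)G_r(z,y)-r^{-1}G_r(x,y).$$
   Context: A (right) random walk on $\Gamma$ is a Markov chain $X_n=x\xi_1\cdots\xi_n$ with $\xi_i$ i.i.d. $\Gamma$-valued. The Green's function is $G_r(x,y)=\sum_{n\ge0}P^x\{X_n=y\}r^n$. The walk is irreducible if the semigroup generated by the support of the law of $\xi_1$ is $\Gamma$; then the radius of convergence $R$ of this series is the same for all $x,y$. *)

theory Defs
  imports "HOL-Probability.Probability" "HOL-Algebra.Group"
begin

locale right_random_walk = G: group G + P: prob_space M
  for G :: "'a monoid" (structure) and M :: "'w measure" +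
  fixes \<xi> :: "nat \<Rightarrow> 'w \<Rightarrow> 'a"
  assumes countable_carrier: "countable (carrier G)"
    and indep_steps: "P.indep_vars (\<lambda>_. count_space (carrier G)) \<xi> {1..}"
    and ident_steps:
      "\<And>i. i \<ge> 1 \<Longrightarrow>
        distr M (count_space (carrier G)) (\<xi> i) = distr M (count_space (carrier G)) (\<xi> 1)"

text \<open>The position $X_n = x \xi_1 \cdots \xi_n$; the step \<open>\<xi> 0\<close> is never used.\<close>

primrec walk_pos ::
  "'a monoid \<Rightarrow> (nat \<Rightarrow> 'w \<Rightarrow> 'a) \<Rightarrow> 'a \<Rightarrow> nat \<Rightarrow> 'w \<Rightarrow> 'a" where
  "walk_pos G \<xi> x 0 \<omega> = x"
| "walk_pos G \<xi> x (Suc n) \<omega> = walk_pos G \<xi> x n \<omega> \<otimes>\<^bsub>G\<^esub> \<xi> (Suc n) \<omega>"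

definition trans_prob ::
  "'a monoid \<Rightarrow> 'w measure \<Rightarrow> (nat \<Rightarrow> 'w \<Rightarrow> 'a) \<Rightarrow> nat \<Rightarrow> 'a \<Rightarrow> 'a \<Rightarrow> real" where
  "trans_prob G M \<xi> n x y = measure M {\<omega> \<in> space M. walk_pos G \<xi> x n \<omega> = y}"

definition step_support ::
  "'a monoid \<Rightarrow> 'w measure \<Rightarrow> (nat \<Rightarrow> 'w \<Rightarrow> 'a) \<Rightarrow> 'a set" where
  "step_support G M \<xi> = {g \<in> carrier G. measure M {\<omega> \<in> space M. \<xi> 1 \<omega> = g} > 0}"

inductive_set semigroup_generated :: "'a monoid \<Rightarrow> 'a set \<Rightarrow> 'a set"
  for G :: "'a monoid" and S :: "'a set" where
  incl: "g \<in> S \<Longrightarrow> g \<in> semigroup_generated G S"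
| mult: "g \<in> semigroup_generated G S \<Longrightarrow> h \<in> semigroup_generated G S \<Longrightarrow>
    g \<otimes>\<^bsub>G\<^esub> h \<in> semigroup_generated G S"

definition irreducible_walk ::
  "'a monoid \<Rightarrow> 'w measure \<Rightarrow> (nat \<Rightarrow> 'w \<Rightarrow> 'a) \<Rightarrow> bool" where
  "irreducible_walk G M \<xi> \<longleftrightarrow> semigroup_generated G (step_support G M \<xi>) = carrier G"

definition green ::
  "'a monoid \<Rightarrow> 'w measure \<Rightarrow> (nat \<Rightarrow> 'w \<Rightarrow> 'a) \<Rightarrow> real \<Rightarrow> 'a \<Rightarrow> 'a \<Rightarrow> real" where
  "green G M \<xi> r x y = (\<Sum>n. trans_prob G M \<xi> n x y * r ^ n)"

text \<open>The radius of convergence common to all pairs of points, possibly infinite a priori. It is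
  well defined for irreducible walks, and is an arbitrary value if the radii differ.\<close>

definition green_radius ::
  "'a monoid \<Rightarrow> 'w measure \<Rightarrow> (nat \<Rightarrow> 'w \<Rightarrow> 'a) \<Rightarrow> ereal" where
  "green_radius G M \<xi> =
    (THE R. \<forall>x \<in> carrier G. \<forall>y \<in> carrier G. conv_radius (\<lambda>n. trans_prob G M \<xi> n x y) = R)"

end

theory Submission
  imports Defs
begin

text \<open>Write \<open>p\<^sub>n(x, y)\<close> for the probability that the walk started at \<open>x\<close> is at \<open>y\<close> at time \<open>n\<close>.
  Both sides of the formula come from the power series \<open>\<Sum>n. (n + 1) p\<^sub>n(x, y) r\<^sup>n\<close>. On the one
  hand, termwise differentiation inside the disc of convergence shows that this series equals
  \<open>r (d/dr) G\<^sub>r(x, y) + G\<^sub>r(x, y)\<close> (\<open>power_series_derivative_weighted\<close>). On the other hand, the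
  Cauchy product of the series of \<open>G\<^sub>r(x, z)\<close> and \<open>G\<^sub>r(z, y)\<close> has \<open>n\<close>-th coefficient
  \<open>\<Sum>i\<le>n. p\<^sub>i(x, z) p\<^bsub>n-i\<^esub>(z, y)\<close>, and summing over \<open>z\<close> turns each of the \<open>n + 1\<close> terms into
  \<open>p\<^sub>n(x, y)\<close> by the Chapman-Kolmogorov equation (\<open>chapman_kolmogorov\<close>,
  \<open>green_product_has_sum\<close>). All terms are nonnegative, so the sums may be interchanged freely, and
  finiteness of the result gives the summability over \<open>z\<close>.

  The Chapman-Kolmogorov equation follows by induction from its one-step case, where the
  independence of the position at time \<open>n\<close> and the next step enters. Irreducibility is needed only
  for the radius of convergence: any two points are joined with positive probability, so the
  Chapman-Kolmogorov inequality bounds each coefficient sequence below by a multiple of a shift of any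
  other one, and all radii coincide (\<open>green_radius_eq_conv_radius\<close>).\<close>

section \<open>Sums of nonnegative functions\<close>

lemma has_sum_if_nn_integral_count_space:
  fixes f :: "'b \<Rightarrow> real"
  assumes nonneg: "\<And>z. z \<in> A \<Longrightarrow> f z \<ge> 0" and "s \<ge> 0"
    and int: "(\<integral>\<^sup>+z. ennreal (f z) \<partial>count_space A) = ennreal s"
  shows "(f has_sum s) A"
proof -
  have "has_bochner_integral (count_space A) f s"
    using assms by (intro has_bochner_integral_nn_integral) (auto simp: AE_count_space)
  then have sum: "Infinite_Set_Sum.abs_summable_on f A" and val: "infsetsum f A = s"
    by (auto simp: abs_summable_on_def infsetsum_def has_bochner_integral_iff)
  from sum have "Infinite_Sum.abs_summable_on f A"
    by (rule abs_summable_equivalent[THEN iffD2])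
  then have "f summable_on A"
    by (rule abs_summable_summable)
  then show ?thesis
    using val infsetsum_infsum[OF sum] by (auto simp: has_sum_infsum)
qed

lemma nn_integral_count_space_swap:
  fixes f :: "'b \<Rightarrow> 'c \<Rightarrow> ennreal"
  assumes "countable A" and "countable B"
  shows "(\<integral>\<^sup>+x. \<integral>\<^sup>+y. f x y \<partial>count_space B \<partial>count_space A)
    = (\<integral>\<^sup>+y. \<integral>\<^sup>+x. f x y \<partial>count_space A \<partial>count_space B)"
proof -
  interpret A: sigma_finite_measure "count_space A"
    using assms(1) by (rule sigma_finite_measure_count_space_countable)
  interpret B: sigma_finite_measure "count_space B"
    using assms(2) by (rule sigma_finite_measure_count_space_countable)
  interpret pair_sigma_finite "count_space A" "count_space B" ..
  show ?thesis
    by (rule Fubini'[symmetric]) (simp add: pair_measure_countable assms)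
qed

section \<open>Power series\<close>

text \<open>A shifted lower bound \<open>c * a n \<le> b (n + k)\<close> compares radii of convergence, because
  multiplying by the fixed power \<open>r ^ k\<close> does not affect summability.\<close>

lemma conv_radius_le_if_shift_le:
  fixes a b :: "nat \<Rightarrow> real"
  assumes "c > 0" and a: "\<And>n. a n \<ge> 0" and le: "\<And>n. c * a n \<le> b (n + k)"
  shows "conv_radius b \<le> conv_radius a"
proof (rule conv_radius_geI_ex')
  fix r :: real
  assume r: "0 < r" "ereal r < conv_radius b"
  have "summable (\<lambda>n. b n * r ^ n)"
    using r by (intro summable_in_conv_radius) auto
  then have "summable (\<lambda>n. b (n + k) * r ^ (n + k))"
    by (subst summable_iff_shift)
  then have "summable (\<lambda>n. (c * r ^ k) * (a n * r ^ n))"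
  proof (rule summable_comparison_test')
    fix n
    have "norm ((c * r ^ k) * (a n * r ^ n)) = (c * a n) * r ^ (n + k)"
      using assms r by (simp add: abs_mult power_add)
    also have "\<dots> \<le> b (n + k) * r ^ (n + k)"
      using r by (intro mult_right_mono le) auto
    finally show "norm ((c * r ^ k) * (a n * r ^ n)) \<le> b (n + k) * r ^ (n + k)" .
  qed
  then have "summable (\<lambda>n. a n * r ^ n)"
    using \<open>c > 0\<close> r by (subst (asm) summable_cmult_iff) auto
  then show "summable (\<lambda>n. a n * of_real r ^ n)"
    by simp
qed

text \<open>Termwise differentiation, rewritten through \<open>r * f' r + f r = (\<Sum>n. (n + 1) * c n * r ^ n)\<close>.\<close>

lemma power_series_derivative_weighted:
  fixes c :: "nat \<Rightarrow> real"
  assumes r: "0 < r" "ereal r < conv_radius c"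
  shows "summable (\<lambda>n. real (Suc n) * (c n * r ^ n))"
    and "((\<lambda>s. \<Sum>n. c n * s ^ n) has_real_derivative
      inverse r * (\<Sum>n. real (Suc n) * (c n * r ^ n)) - inverse r * (\<Sum>n. c n * r ^ n)) (at r)"
proof -
  obtain K where K: "ereal r < ereal K" "ereal K < conv_radius c"
    using ereal_dense2[OF r(2)] by auto
  have sumK: "summable (\<lambda>n. c n * x ^ n)" if "norm x < K" for x
    using that by (intro summable_in_conv_radius less_trans[OF _ K(2)]) simp
  have rK: "norm r < K"
    using r K by simp
  let ?D = "\<Sum>n. diffs c n * r ^ n"
  have deriv: "((\<lambda>s. \<Sum>n. c n * s ^ n) has_real_derivative ?D) (at r)"
    by (rule termdiffs_strong'[OF sumK rK])
  have "(\<lambda>n. of_nat n * c n * r ^ (n - Suc 0)) sums ?D"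
    by (intro diffs_equiv termdiff_converges[OF rK sumK])
  then have "(\<lambda>n. r * (of_nat n * c n * r ^ (n - Suc 0)) + c n * r ^ n) sums
      (r * ?D + (\<Sum>n. c n * r ^ n))"
    by (intro sums_add sums_mult summable_sums sumK[OF rK])
  moreover have "r * (of_nat n * c n * r ^ (n - Suc 0)) + c n * r ^ n
      = real (Suc n) * (c n * r ^ n)" for n
    by (cases n) (simp_all add: algebra_simps)
  ultimately have S: "(\<lambda>n. real (Suc n) * (c n * r ^ n)) sums (r * ?D + (\<Sum>n. c n * r ^ n))"
    by simp
  then show "summable (\<lambda>n. real (Suc n) * (c n * r ^ n))"
    by (rule sums_summable)
  have "?D = inverse r * (\<Sum>n. real (Suc n) * (c n * r ^ n)) - inverse r * (\<Sum>n. c n * r ^ n)"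
    using sums_unique[OF S] r(1) by (simp add: field_simps)
  with deriv show "((\<lambda>s. \<Sum>n. c n * s ^ n) has_real_derivative
      inverse r * (\<Sum>n. real (Suc n) * (c n * r ^ n)) - inverse r * (\<Sum>n. c n * r ^ n)) (at r)"
    by simp
qed

section \<open>Transition probabilities\<close>

text \<open>The steps may live on any measurable space: the statement is used both on the probability
  space and on the space of step sequences.\<close>

lemma walk_pos_measurable:
  assumes "group G" and "countable (carrier G)" and "x \<in> carrier G"
    and "\<And>i. i \<in> {1..n} \<Longrightarrow> \<xi> i \<in> measurable N (count_space (carrier G))"
  shows "walk_pos G \<xi> x n \<in> measurable N (count_space (carrier G))"
  using assms(4)
proof (induction n)
  case 0
  then show ?case using assms(3) by simp
next
  case (Suc n)
  interpret group G by fact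
  have "(\<lambda>\<omega>. z \<otimes>\<^bsub>G\<^esub> \<xi> (Suc n) \<omega>) \<in> measurable N (count_space (carrier G))"
    if "z \<in> carrier G" for z
    by (rule measurable_compose[OF Suc.prems]) (use that in auto)
  moreover have "walk_pos G \<xi> x n \<in> measurable N (count_space (carrier G))"
    using Suc by simp
  ultimately have "(\<lambda>\<omega>. walk_pos G \<xi> x n \<omega> \<otimes>\<^bsub>G\<^esub> \<xi> (Suc n) \<omega>)
      \<in> measurable N (count_space (carrier G))"
    using assms(2) by (rule measurable_compose_countable')
  then show ?case by (simp add: fun_eq_iff cong: measurable_cong)
qed

text \<open>The position at time \<open>n\<close> is a function of the first \<open>n\<close> steps: it is the walk driven by the
  coordinate functions, evaluated at the step sequence.\<close>

lemma walk_pos_restrict: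
  "walk_pos G (\<lambda>i f. f i) x n (restrict (\<lambda>i. \<xi> i \<omega>) {1..n}) = walk_pos G \<xi> x n \<omega>"
proof -
  have "walk_pos G (\<lambda>i f. f i) x m (restrict (\<lambda>i. \<xi> i \<omega>) {1..n}) = walk_pos G \<xi> x m \<omega>"
    if "m \<le> n" for m
    using that by (induction m) auto
  then show ?thesis by simp
qed

context right_random_walk
begin

text \<open>The \<open>n\<close>-step transition probabilities of the walk.\<close>

abbreviation p :: "nat \<Rightarrow> 'a \<Rightarrow> 'a \<Rightarrow> real" where
  "p n x y \<equiv> trans_prob G M \<xi> n x y"

lemma step_measurable: "i \<ge> 1 \<Longrightarrow> \<xi> i \<in> measurable M (count_space (carrier G))"
  using indep_steps unfolding P.indep_vars_def2 by auto

lemma position_measurable: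
  "x \<in> carrier G \<Longrightarrow> walk_pos G \<xi> x n \<in> measurable M (count_space (carrier G))"
  by (rule walk_pos_measurable) (auto simp: countable_carrier intro: step_measurable G.is_group)

lemma position_in_carrier:
  "x \<in> carrier G \<Longrightarrow> \<omega> \<in> space M \<Longrightarrow> walk_pos G \<xi> x n \<omega> \<in> carrier G"
  using measurable_space[OF position_measurable] by fastforce

lemma step_in_carrier: "i \<ge> 1 \<Longrightarrow> \<omega> \<in> space M \<Longrightarrow> \<xi> i \<omega> \<in> carrier G"
  using measurable_space[OF step_measurable] by fastforce

lemma step_prob:
  assumes "i \<ge> 1" and "g \<in> carrier G"
  shows "measure M {\<omega> \<in> space M. \<xi> i \<omega> = g} = measure M {\<omega> \<in> space M. \<xi> 1 \<omega> = g}"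
proof -
  have "measure (distr M (count_space (carrier G)) (\<xi> j)) {g} = measure M {\<omega> \<in> space M. \<xi> j \<omega> = g}"
    if "j \<ge> 1" for j
    using step_measurable[OF that] assms(2)
    by (subst measure_distr) (auto intro!: arg_cong[where f = "measure M"])
  with ident_steps[OF assms(1)] assms(1) show ?thesis
    by (metis order_refl)
qed

text \<open>The position at time \<open>n\<close> depends only on the steps \<open>1, \<dots>, n\<close>, hence it is independent of
  step \<open>n + 1\<close>.\<close>

lemma position_step_indep:
  assumes "x \<in> carrier G" and "z \<in> carrier G" and "g \<in> carrier G"
  shows "measure M {\<omega> \<in> space M. walk_pos G \<xi> x n \<omega> = z \<and> \<xi> (Suc n) \<omega> = g}
    = p n x z * measure M {\<omega> \<in> space M. \<xi> 1 \<omega> = g}"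
proof -
  let ?C = "\<lambda>_::nat. count_space (carrier G)"
  let ?past = "walk_pos G (\<lambda>i f. f i) x n" and ?next = "\<lambda>f. f (Suc n)"
  let ?R = "\<lambda>A \<omega>. restrict (\<lambda>i. \<xi> i \<omega>) A"
  have "P.indep_var (PiM {1..n} ?C) (?R {1..n}) (PiM {Suc n} ?C) (?R {Suc n})"
    by (rule P.indep_var_restrict[OF indep_steps]) auto
  moreover have "?past \<in> measurable (PiM {1..n} ?C) (count_space (carrier G))"
    by (rule walk_pos_measurable) (use assms(1) in \<open>auto simp: countable_carrier intro: G.is_group\<close>)
  moreover have "?next \<in> measurable (PiM {Suc n} ?C) (count_space (carrier G))"
    by (rule measurable_component_singleton) simp
  ultimately have "P.indep_var (count_space (carrier G)) (?past \<circ> ?R {1..n})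
      (count_space (carrier G)) (?next \<circ> ?R {Suc n})"
    by (rule P.indep_var_compose)
  moreover have "?past \<circ> ?R {1..n} = walk_pos G \<xi> x n"
    by (rule ext) (simp only: o_apply walk_pos_restrict)
  moreover have "?next \<circ> ?R {Suc n} = \<xi> (Suc n)"
    by auto
  ultimately have "P.indep_var (count_space (carrier G)) (walk_pos G \<xi> x n)
      (count_space (carrier G)) (\<xi> (Suc n))"
    by simp
  from P.indep_varD[OF this, of "{z}" "{g}"] assms
  have "measure M ((\<lambda>\<omega>. (walk_pos G \<xi> x n \<omega>, \<xi> (Suc n) \<omega>)) -` ({z} \<times> {g}) \<inter> space M) =
      measure M (walk_pos G \<xi> x n -` {z} \<inter> space M) * measure M (\<xi> (Suc n) -` {g} \<inter> space M)"
    by simp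
  moreover have "(\<lambda>\<omega>. (walk_pos G \<xi> x n \<omega>, \<xi> (Suc n) \<omega>)) -` ({z} \<times> {g}) \<inter> space M
      = {\<omega> \<in> space M. walk_pos G \<xi> x n \<omega> = z \<and> \<xi> (Suc n) \<omega> = g}"
    "walk_pos G \<xi> x n -` {z} \<inter> space M = {\<omega> \<in> space M. walk_pos G \<xi> x n \<omega> = z}"
    "\<xi> (Suc n) -` {g} \<inter> space M = {\<omega> \<in> space M. \<xi> (Suc n) \<omega> = g}"
    by auto
  ultimately show ?thesis
    using step_prob[of "Suc n" g] assms(3) by (simp add: trans_prob_def)
qed

lemma trans_prob_nonneg: "p n x y \<ge> 0"
  by (simp add: trans_prob_def)

lemma trans_prob_0: "p 0 x y = (if x = y then 1 else 0)"
  by (simp add: trans_prob_def P.prob_space)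

lemma trans_prob_1:
  assumes "x \<in> carrier G" and "g \<in> carrier G"
  shows "p 1 x (x \<otimes> g) = measure M {\<omega> \<in> space M. \<xi> 1 \<omega> = g}"
  unfolding trans_prob_def using assms step_in_carrier[of 1]
  by (auto intro!: arg_cong[where f = "measure M"])

text \<open>The one-step decomposition: the events that the walk is at \<open>z\<close> at time \<open>n\<close> and the next step
  is \<open>inv z \<otimes> y\<close> partition the event that it is at \<open>y\<close> at time \<open>n + 1\<close>.\<close>

lemma trans_prob_Suc:
  assumes "x \<in> carrier G" and "y \<in> carrier G"
  shows "ennreal (p (Suc n) x y)
    = (\<integral>\<^sup>+z. ennreal (p n x z) * ennreal (p 1 z y) \<partial>count_space (carrier G))"
proof -
  let ?E = "\<lambda>z. {\<omega> \<in> space M. walk_pos G \<xi> x n \<omega> = z \<and> \<xi> (Suc n) \<omega> = inv z \<otimes> y}"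
  have split: "{\<omega> \<in> space M. walk_pos G \<xi> x (Suc n) \<omega> = y} = (\<Union>z\<in>carrier G. ?E z)"
    using assms position_in_carrier[OF assms(1)] step_in_carrier[of "Suc n"]
    by (auto simp: G.m_assoc[symmetric])
  have sets: "?E z \<in> sets M" if "z \<in> carrier G" for z
  proof -
    have "?E z = (walk_pos G \<xi> x n -` {z} \<inter> space M) \<inter> (\<xi> (Suc n) -` {inv z \<otimes> y} \<inter> space M)"
      by auto
    then show ?thesis
      using that assms
      by (auto intro!: sets.Int measurable_sets[OF position_measurable]
          measurable_sets[OF step_measurable])
  qed
  have "ennreal (p (Suc n) x y) = emeasure M (\<Union>z\<in>carrier G. ?E z)"
    unfolding trans_prob_def split by (simp add: P.emeasure_eq_measure)
  also have "\<dots> = (\<integral>\<^sup>+z. emeasure M (?E z) \<partial>count_space (carrier G))"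
    by (rule emeasure_UN_countable[OF sets countable_carrier])
      (auto simp: disjoint_family_on_def)
  also have "\<dots> = (\<integral>\<^sup>+z. ennreal (p n x z) * ennreal (p 1 z y) \<partial>count_space (carrier G))"
  proof (rule nn_integral_cong)
    fix z assume "z \<in> space (count_space (carrier G))"
    then have z: "z \<in> carrier G" by simp
    have "p 1 z y = measure M {\<omega> \<in> space M. \<xi> 1 \<omega> = inv z \<otimes> y}"
      using trans_prob_1[of z "inv z \<otimes> y"] z assms by (simp add: G.m_assoc[symmetric])
    then have "measure M (?E z) = p n x z * p 1 z y"
      using position_step_indep[of x z "inv z \<otimes> y" n] z assms by simp
    then show "emeasure M (?E z) = ennreal (p n x z) * ennreal (p 1 z y)"
      by (simp add: P.emeasure_eq_measure ennreal_mult trans_prob_nonneg)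
  qed
  finally show ?thesis .
qed

text \<open>The sum over intermediate points is an integral of extended nonnegative reals against
  counting measure, so that no summability has to be carried along.\<close>

lemma chapman_kolmogorov:
  assumes "x \<in> carrier G" and "y \<in> carrier G"
  shows "ennreal (p (m + n) x y)
    = (\<integral>\<^sup>+z. ennreal (p m x z) * ennreal (p n z y) \<partial>count_space (carrier G))"
  using assms(2)
proof (induction n arbitrary: y)
  case 0
  have "(\<integral>\<^sup>+z. ennreal (p m x z) * ennreal (p 0 z y) \<partial>count_space (carrier G))
      = (\<Sum>z\<in>{y}. ennreal (p m x z) * ennreal (p 0 z y))"
    by (rule nn_integral_count_space') (use 0 in \<open>auto simp: trans_prob_0\<close>)
  then show ?case by (simp add: trans_prob_0)
next
  case (Suc n)
  let ?C = "count_space (carrier G)"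
  have "ennreal (p (m + Suc n) x y) = (\<integral>\<^sup>+w. ennreal (p (m + n) x w) * ennreal (p 1 w y) \<partial>?C)"
    using trans_prob_Suc[OF assms(1) Suc.prems, of "m + n"] by simp
  also have "\<dots> = (\<integral>\<^sup>+w. (\<integral>\<^sup>+z. ennreal (p m x z) * (ennreal (p n z w) * ennreal (p 1 w y)) \<partial>?C) \<partial>?C)"
    by (intro nn_integral_cong)
      (simp add: Suc.IH nn_integral_multc[symmetric] mult.assoc)
  also have "\<dots> = (\<integral>\<^sup>+z. (\<integral>\<^sup>+w. ennreal (p m x z) * (ennreal (p n z w) * ennreal (p 1 w y)) \<partial>?C) \<partial>?C)"
    by (intro nn_integral_count_space_swap countable_carrier)
  also have "\<dots> = (\<integral>\<^sup>+z. ennreal (p m x z) * ennreal (p (Suc n) z y) \<partial>?C)"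
    by (intro nn_integral_cong) (simp add: trans_prob_Suc[OF _ Suc.prems] nn_integral_cmult)
  finally show ?case .
qed

lemma trans_prob_mult_le:
  assumes "x \<in> carrier G" and "z \<in> carrier G" and "y \<in> carrier G"
  shows "p m x z * p n z y \<le> p (m + n) x y"
proof -
  have "ennreal (p m x z) * ennreal (p n z y)
      \<le> (\<integral>\<^sup>+w. ennreal (p m x w) * ennreal (p n w y) \<partial>count_space (carrier G))"
    using assms(2) by (intro nn_integral_ge_point) auto
  also have "\<dots> = ennreal (p (m + n) x y)"
    by (rule chapman_kolmogorov[OF assms(1,3), symmetric])
  finally show ?thesis
    by (simp add: trans_prob_nonneg flip: ennreal_mult)
qed

section \<open>Irreducibility and the common radius of convergence\<close>

text \<open>Products in the semigroup correspond to concatenating paths of positive probability.\<close>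

lemma semigroup_generated_reachable:
  assumes "g \<in> semigroup_generated G (step_support G M \<xi>)"
  shows "g \<in> carrier G \<and> (\<forall>x \<in> carrier G. \<exists>n. p n x (x \<otimes> g) > 0)"
  using assms
proof induction
  case (incl g)
  then have g: "g \<in> carrier G" and pos: "measure M {\<omega> \<in> space M. \<xi> 1 \<omega> = g} > 0"
    by (auto simp: step_support_def)
  have "p 1 x (x \<otimes> g) > 0" if "x \<in> carrier G" for x
    using trans_prob_1[OF that g] pos by simp
  with g show ?case by blast
next
  case (mult g h)
  show ?case
  proof (intro conjI ballI)
    fix x assume x: "x \<in> carrier G"
    obtain m n where mn: "p m x (x \<otimes> g) > 0" "p n (x \<otimes> g) (x \<otimes> g \<otimes> h) > 0"
      using mult.IH x by (meson G.m_closed)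
    have "0 < p m x (x \<otimes> g) * p n (x \<otimes> g) (x \<otimes> g \<otimes> h)"
      using mn by simp
    also have "\<dots> \<le> p (m + n) x (x \<otimes> g \<otimes> h)"
      using x mult.IH by (intro trans_prob_mult_le) auto
    finally show "\<exists>n. p n x (x \<otimes> (g \<otimes> h)) > 0"
      using x mult.IH by (auto simp: G.m_assoc)
  qed (use mult.IH in auto)
qed

lemma irreducible_reachable:
  assumes "irreducible_walk G M \<xi>" and "x \<in> carrier G" and "y \<in> carrier G"
  obtains n where "p n x y > 0"
proof -
  have "inv x \<otimes> y \<in> semigroup_generated G (step_support G M \<xi>)"
    using assms by (simp add: irreducible_walk_def)
  from semigroup_generated_reachable[OF this] assms
  obtain n where "p n x (x \<otimes> (inv x \<otimes> y)) > 0" by blast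
  then show thesis
    using assms that by (simp add: G.m_assoc[symmetric])
qed

text \<open>If, with positive probability, \<open>u\<close> leads to \<open>x\<close> in \<open>i\<close> steps and \<open>y\<close> leads to \<open>v\<close> in \<open>j\<close> steps, then
  \<open>p i u x * p n x y * p j y v \<le> p (i + n + j) u v\<close>; by symmetry all radii agree.\<close>

lemma conv_radius_trans_prob_le:
  assumes "irreducible_walk G M \<xi>"
    and xyuv: "x \<in> carrier G" "y \<in> carrier G" "u \<in> carrier G" "v \<in> carrier G"
  shows "conv_radius (\<lambda>n. p n u v) \<le> conv_radius (\<lambda>n. p n x y)"
proof -
  obtain i where i: "p i u x > 0"
    using irreducible_reachable assms by metis
  obtain j where j: "p j y v > 0"
    using irreducible_reachable assms by metis
  have "(p i u x * p j y v) * p n x y \<le> p (n + (i + j)) u v" for n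
  proof -
    have "(p i u x * p j y v) * p n x y = p i u x * p n x y * p j y v"
      by simp
    also have "\<dots> \<le> p (i + n) u y * p j y v"
      by (intro mult_right_mono trans_prob_mult_le xyuv trans_prob_nonneg)
    also have "\<dots> \<le> p (i + n + j) u v"
      by (intro trans_prob_mult_le xyuv)
    finally show ?thesis
      by (simp add: ac_simps)
  qed
  with i j show ?thesis
    by (intro conv_radius_le_if_shift_le[where c = "p i u x * p j y v" and k = "i + j"])
      (auto simp: trans_prob_nonneg)
qed

text \<open>The definite description defining the radius is therefore well defined.\<close>

lemma green_radius_eq_conv_radius:
  assumes "irreducible_walk G M \<xi>" and "x \<in> carrier G" and "y \<in> carrier G"
  shows "green_radius G M \<xi> = conv_radius (\<lambda>n. p n x y)"
  unfolding green_radius_def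
proof (rule the_equality)
  show "\<forall>u\<in>carrier G. \<forall>v\<in>carrier G. conv_radius (\<lambda>n. p n u v) = conv_radius (\<lambda>n. p n x y)"
    using conv_radius_trans_prob_le[OF assms(1)] assms(2,3) by (meson antisym)
qed (use assms in auto)

section \<open>Products of Green's functions\<close>

text \<open>In the double sum over \<open>z\<close> and \<open>(i, j)\<close>, grouping by \<open>k = i + j\<close> and applying
  Chapman-Kolmogorov leaves \<open>k + 1\<close> equal terms for each \<open>k\<close>.\<close>

lemma green_product_has_sum:
  assumes irr: "irreducible_walk G M \<xi>" and x: "x \<in> carrier G" and y: "y \<in> carrier G"
    and r: "0 < r" "ereal r < green_radius G M \<xi>"
  shows "((\<lambda>z. green G M \<xi> r x z * green G M \<xi> r z y) has_sum
    (\<Sum>n. real (Suc n) * (p n x y * r ^ n))) (carrier G)"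
proof (rule has_sum_if_nn_integral_count_space)
  let ?C = "count_space (carrier G)"
  let ?a = "\<lambda>u v n. p n u v * r ^ n"
  have a_nonneg: "?a u v n \<ge> 0" for u v n
    using r by (simp add: trans_prob_nonneg)
  have a_sum: "summable (?a u v)" if "u \<in> carrier G" "v \<in> carrier G" for u v
    using r green_radius_eq_conv_radius[OF irr that] by (intro summable_in_conv_radius) auto
  show "green G M \<xi> r x z * green G M \<xi> r z y \<ge> 0" if "z \<in> carrier G" for z
    unfolding green_def using that x y
    by (intro mult_nonneg_nonneg suminf_nonneg a_sum a_nonneg)
  have w_sum: "summable (\<lambda>n. real (Suc n) * ?a x y n)"
    using r green_radius_eq_conv_radius[OF irr x y]
    by (intro power_series_derivative_weighted(1)) auto
  have w_nonneg: "real (Suc n) * ?a x y n \<ge> 0" for n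
    by (intro mult_nonneg_nonneg a_nonneg) auto
  show "(\<Sum>n. real (Suc n) * ?a x y n) \<ge> 0"
    by (intro suminf_nonneg w_sum w_nonneg)
  have cauchy: "ennreal (green G M \<xi> r x z * green G M \<xi> r z y)
      = (\<Sum>k. \<Sum>i\<le>k. ennreal (p i x z) * ennreal (p (k - i) z y) * ennreal (r ^ k))"
    if z: "z \<in> carrier G" for z
  proof -
    have "(\<lambda>k. \<Sum>i\<le>k. ?a x z i * ?a z y (k - i)) sums (green G M \<xi> r x z * green G M \<xi> r z y)"
      unfolding green_def using a_sum x y z a_nonneg
      by (intro Cauchy_product_sums) (simp_all add: abs_of_nonneg)
    then have "ennreal (green G M \<xi> r x z * green G M \<xi> r z y)
        = (\<Sum>k. ennreal (\<Sum>i\<le>k. ?a x z i * ?a z y (k - i)))"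
      by (subst suminf_ennreal2) (auto simp: sums_iff intro!: sum_nonneg mult_nonneg_nonneg a_nonneg)
    also have "\<dots> = (\<Sum>k. \<Sum>i\<le>k. ennreal (p i x z) * ennreal (p (k - i) z y) * ennreal (r ^ k))"
    proof (intro suminf_cong)
      fix k
      have "(\<Sum>i\<le>k. ?a x z i * ?a z y (k - i)) = (\<Sum>i\<le>k. p i x z * p (k - i) z y * r ^ k)"
        by (intro sum.cong refl) (auto simp: power_add[symmetric] mult_ac)
      also have "ennreal \<dots> = (\<Sum>i\<le>k. ennreal (p i x z) * ennreal (p (k - i) z y) * ennreal (r ^ k))"
        using r trans_prob_nonneg
        by (subst sum_ennreal[symmetric]) (auto simp: ennreal_mult intro!: sum.cong)
      finally show "ennreal (\<Sum>i\<le>k. ?a x z i * ?a z y (k - i))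
          = (\<Sum>i\<le>k. ennreal (p i x z) * ennreal (p (k - i) z y) * ennreal (r ^ k))" .
    qed
    finally show ?thesis .
  qed
  have "(\<integral>\<^sup>+z. ennreal (green G M \<xi> r x z * green G M \<xi> r z y) \<partial>?C)
      = (\<integral>\<^sup>+z. (\<Sum>k. \<Sum>i\<le>k. ennreal (p i x z) * ennreal (p (k - i) z y) * ennreal (r ^ k)) \<partial>?C)"
    by (intro nn_integral_cong) (simp add: cauchy)
  also have "\<dots> = (\<Sum>k. \<Sum>i\<le>k. (\<integral>\<^sup>+z. ennreal (p i x z) * ennreal (p (k - i) z y) * ennreal (r ^ k) \<partial>?C))"
    by (subst nn_integral_suminf, simp, subst nn_integral_sum) simp_all
  also have "\<dots> = (\<Sum>k. \<Sum>i\<le>k. ennreal (p k x y) * ennreal (r ^ k))"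
    by (intro suminf_cong sum.cong refl)
      (simp add: nn_integral_multc chapman_kolmogorov[OF x y, symmetric])
  also have "\<dots> = (\<Sum>k. ennreal (real (Suc k) * ?a x y k))"
    using r by (simp add: ennreal_mult trans_prob_nonneg ennreal_of_nat_eq_real_of_nat del: of_nat_Suc)
  also have "\<dots> = ennreal (\<Sum>k. real (Suc k) * ?a x y k)"
    by (rule suminf_ennreal2[OF w_nonneg w_sum])
  finally show "(\<integral>\<^sup>+z. ennreal (green G M \<xi> r x z * green G M \<xi> r z y) \<partial>?C)
      = ennreal (\<Sum>n. real (Suc n) * ?a x y n)" .
qed

end

section \<open>The derivative of Green's function\<close>

theorem proposition1p9:
  fixes G :: "'a monoid" and M :: "'w measure" and \<xi> :: "nat \<Rightarrow> 'w \<Rightarrow> 'a"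
    and x y :: 'a and r :: real
  assumes "right_random_walk G M \<xi>"
    and "irreducible_walk G M \<xi>"
    and "x \<in> carrier G" and "y \<in> carrier G"
    and "0 < r" and "ereal r < green_radius G M \<xi>"
  shows "(\<lambda>z. green G M \<xi> r x z * green G M \<xi> r z y) summable_on carrier G \<and>
    ((\<lambda>s. green G M \<xi> s x y) has_real_derivative
      inverse r * (\<Sum>\<^sub>\<infinity>z\<in>carrier G. green G M \<xi> r x z * green G M \<xi> r z y)
      - inverse r * green G M \<xi> r x y) (at r)"
proof
  interpret right_random_walk G M \<xi> by fact
  have sum: "((\<lambda>z. green G M \<xi> r x z * green G M \<xi> r z y) has_sum
      (\<Sum>n. real (Suc n) * (p n x y * r ^ n))) (carrier G)"
    by (rule green_product_has_sum) fact+
  then show "(\<lambda>z. green G M \<xi> r x z * green G M \<xi> r z y) summable_on carrier G"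
    by (rule has_sum_imp_summable)
  have "ereal r < conv_radius (\<lambda>n. p n x y)"
    using assms green_radius_eq_conv_radius by metis
  from power_series_derivative_weighted(2)[OF assms(5) this]
  show "((\<lambda>s. green G M \<xi> s x y) has_real_derivative
      inverse r * (\<Sum>\<^sub>\<infinity>z\<in>carrier G. green G M \<xi> r x z * green G M \<xi> r z y)
      - inverse r * green G M \<xi> r x y) (at r)"
    unfolding infsumI[OF sum] unfolding green_def .
qed

end
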